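(* Let $\mathcal C\subset\mathbb R^d$ be a relatively open convex set and let $\mathcal D=\{q_1,\dots,q_N\}\subset\mathbb R^d$ be a finite data set. Then $\mathcal D$ is a sufficient decision dataset for the uncertainty set $\mathcal C$ and decision set $\mathcal X$ if and only if $$\Delta(\mathcal X,\mathcal C)\subset \mathrm{dir}(\mathcal C)^\perp+\mathrm{span}\,\mathcal D .$$
   Context: Let $A\in\mathbb R^{m\times d}$, $b\in\mathbb R^m$, and let $\mathcal X=\{x\in\mathbb R^d: Ax=b,\ x\ge 0\}$, assumed bounded. Let $\mathcal X^\angle$ be the set of extreme points of $\mathcal X$. Sufficiency: $\mathcal D=\{q_1,\dots,q_N\}$ is a sufficient decision dataset for $\mathcal C$ and $\mathcal X$ if there is a map $\hat X:\mathbb R^N\to\mathcal P(\mathcal X)$ (the set of subsets of $\mathcal X$) such that $\hat X(c^\top q_1,\dots,c^\top q_N)=\arg\min_{x\in\mathcal X}c^\top x$ for all $c\in\mathcal C$. For $x^\star\in\mathcal X^\angle$: $\mathrm{FD}(x^\star)=\{\delta\in\mathbb R^d:\exists\varepsilon>0,\ x^\star+\varepsilon\delta\in\mathcal X\}$ is the polyhedral cone of feasible directions; $D(x^\star)$ is the set of extreme directions of $\mathrm{FD}(x^\star)$ (nonzero vectors generating extreme rays of this cone); $\Lambda(x^\star)=\{c\in\mathbb R^d: x^\star\in\arg\min_{x\in\mathcal X}c^\top x\}$; and for $\delta\in D(x^\star)$, $F(x^\star,\delta)=\Lambda(x^\star)\cap\{\delta\}^\perp$. Relevant extreme directions: $\Delta(\mathcal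 X,\mathcal C)=\{\delta\in\mathbb R^d:\exists x^\star\in\mathcal X^\angle,\ \delta\in D(x^\star)\text{ and }F(x^\star,\delta)\cap\mathcal C\ne\varnothing\}$. For a set $S\subset\mathbb R^d$, $\mathrm{dir}(S)=\mathrm{span}\{x_1-x_2:x_1,x_2\in S\}$. $S$ is relatively open if it equals its relative interior, i.e. every $x\in S$ has some $\varepsilon>0$ with $B(x,\varepsilon)\cap\mathrm{Aff}(S)\subset S$, where $\mathrm{Aff}(S)$ is the affine hull and $B(x,\varepsilon)$ the open Euclidean ball. $\perp$ denotes orthogonal complement. *)

theory Defs
  imports "HOL-Analysis.Analysis"
begin

definition decision_set :: "real ^ 'd ^ 'm \<Rightarrow> real ^ 'm \<Rightarrow> (real ^ 'd) set" where
  "decision_set A b = {x. A *v x = b \<and> (\<forall>i. 0 \<le> x $ i)}"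

definition argmin_set :: "('a::real_inner) set \<Rightarrow> 'a \<Rightarrow> 'a set" where
  "argmin_set X c = {x. is_arg_min (\<lambda>y. c \<bullet> y) (\<lambda>y. y \<in> X) x}"

text \<open>The dataset \<open>{q\<^sub>1, \<dots>, q\<^sub>N}\<close> is given by an enumeration \<open>qs\<close> with \<open>N = length qs\<close>, and
  \<open>\<real>\<^sup>N\<close> consists of the real lists of length \<open>N\<close>. The value of \<open>Xhat\<close> on lists of any
  other length is irrelevant.\<close>

definition sufficient_dataset ::
    "('a::real_inner) list \<Rightarrow> 'a set \<Rightarrow> 'a set \<Rightarrow> bool" where
  "sufficient_dataset qs C X \<longleftrightarrow>
     (\<exists>Xhat :: real list \<Rightarrow> 'a set.
        (\<forall>ys. length ys = length qs \<longrightarrow> Xhat ys \<subseteq> X) \<and>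
        (\<forall>c\<in>C. Xhat (map (\<lambda>q. c \<bullet> q) qs) = argmin_set X c))"

definition feasible_directions :: "('a::real_vector) set \<Rightarrow> 'a \<Rightarrow> 'a set" where
  "feasible_directions X x = {\<delta>. \<exists>\<epsilon>>0. x + \<epsilon> *\<^sub>R \<delta> \<in> X}"

text \<open>For nonzero \<open>\<delta>\<close>, the conic hull of \<open>{\<delta>}\<close> is the ray \<open>{t *\<^sub>R \<delta> | t \<ge> 0}\<close>; it is an extreme ray
  of the cone if it is a face of it.\<close>

definition extreme_directions :: "('a::real_vector) set \<Rightarrow> 'a \<Rightarrow> 'a set" where
  "extreme_directions X x =
     {\<delta>. \<delta> \<noteq> 0 \<and> (conic hull {\<delta>}) face_of (feasible_directions X x)}"

definition optimality_cone :: "('a::real_inner) set \<Rightarrow> 'a \<Rightarrow> 'a set" where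
  "optimality_cone X x = {c. x \<in> argmin_set X c}"

definition optimality_face :: "('a::real_inner) set \<Rightarrow> 'a \<Rightarrow> 'a \<Rightarrow> 'a set" where
  "optimality_face X x \<delta> = optimality_cone X x \<inter> orthogonal_comp {\<delta>}"

definition relevant_extreme_directions :: "('a::real_inner) set \<Rightarrow> 'a set \<Rightarrow> 'a set" where
  "relevant_extreme_directions X C =
     {\<delta>. \<exists>x. x extreme_point_of X \<and> \<delta> \<in> extreme_directions X x \<and>
           optimality_face X x \<delta> \<inter> C \<noteq> {}}"

definition dir :: "('a::real_vector) set \<Rightarrow> 'a set" where
  "dir S = span {x1 - x2 | x1 x2. x1 \<in> S \<and> x2 \<in> S}"

end

theory Submission
  imports Defs
begin

text \<open>If the inclusion fails, some \<open>s \<in> dir C\<close> orthogonal to the data is not orthogonal to a relevant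
  direction \<open>\<delta>\<close> at \<open>x\<close>, say with \<open>c \<in> F(x, \<delta>) \<inter> C\<close>; moving \<open>c\<close> slightly along \<open>s\<close> stays in \<open>C\<close>,
  leaves the data unchanged, but breaks the tie between \<open>x\<close> and \<open>x + \<epsilon> \<delta>\<close>.
  Conversely, suppose \<open>c, c' \<in> C\<close> give the same data and the vertex \<open>x\<close> is optimal for \<open>c\<close> but not
  for \<open>c'\<close>. The feasible cone at \<open>x\<close> is generated by finitely many extreme directions, so there is a
  last point of the segment from \<open>c\<close> to \<open>c'\<close> at which \<open>x\<close> is optimal, and there some extreme direction
  \<open>\<delta>\<close> with \<open>c' \<bullet> \<delta> < 0\<close> becomes tight. It is relevant, hence orthogonal to \<open>c - c'\<close>, a contradiction.\<close>

section \<open>Optimal sets\<close>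

lemma argmin_set_iff: "x \<in> argmin_set X c \<longleftrightarrow> x \<in> X \<and> (\<forall>y\<in>X. c \<bullet> x \<le> c \<bullet> y)"
  by (auto simp: argmin_set_def is_arg_min_linorder)

text \<open>If nonempty, the optimal set is the slice of \<open>X\<close> by the supporting
  hyperplane at the optimal value.\<close>

lemma argmin_set_face_of:
  assumes "convex X"
  shows "argmin_set X c face_of X"
proof (cases "argmin_set X c = {}")
  case False
  then obtain y where y: "y \<in> X" "\<And>z. z \<in> X \<Longrightarrow> c \<bullet> y \<le> c \<bullet> z"
    unfolding ex_in_conv[symmetric] argmin_set_iff by blast
  have "z \<in> argmin_set X c \<longleftrightarrow> z \<in> X \<and> c \<bullet> z = c \<bullet> y" for z
    unfolding argmin_set_iff using y by (metis order_antisym)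
  then have "argmin_set X c = X \<inter> {z. c \<bullet> z = c \<bullet> y}"
    by blast
  with face_of_Int_supporting_hyperplane_ge[OF assms y(2)] show ?thesis
    by simp
qed simp

text \<open>By Krein-Milman the first optimal set is the hull of its extreme points. As it is a
  face, these are extreme points of \<open>X\<close>, so they lie in the second, convex, optimal
  set.\<close>

lemma argmin_set_subset_if_extreme_points:
  fixes X :: "'a::euclidean_space set"
  assumes "compact X" "convex X"
    and "\<And>x. x extreme_point_of X \<Longrightarrow> x \<in> argmin_set X c \<Longrightarrow> x \<in> argmin_set X c'"
  shows "argmin_set X c \<subseteq> argmin_set X c'"
proof -
  have face: "argmin_set X c face_of X" "argmin_set X c' face_of X"
    using assms(2) by (rule argmin_set_face_of)+
  have "argmin_set X c = convex hull {x. x extreme_point_of argmin_set X c}"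
    using face assms by (intro Krein_Milman_Minkowski)
      (auto intro: face_of_imp_compact face_of_imp_convex)
  also have "\<dots> \<subseteq> argmin_set X c'"
    using face assms by (intro hull_minimal)
      (auto simp: extreme_point_of_face intro: face_of_imp_convex)
  finally show ?thesis .
qed

text \<open>A map of the data with the required values exists exactly when the optimal set is
  constant on the fibres of the data map; this removes the quantifier over
  \<open>Xhat\<close>.\<close>

lemma sufficient_dataset_iff:
  "sufficient_dataset qs C X \<longleftrightarrow>
     (\<forall>c\<in>C. \<forall>c'\<in>C. (\<forall>q\<in>set qs. c \<bullet> q = c' \<bullet> q) \<longrightarrow> argmin_set X c = argmin_set X c')"
  (is "?L \<longleftrightarrow> ?R")
proof
  assume ?L
  then obtain Xhat where "\<forall>c\<in>C. Xhat (map (\<lambda>q. c \<bullet> q) qs) = argmin_set X c"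
    unfolding sufficient_dataset_def by (elim exE conjE)
  note Xhat = this[rule_format]
  show ?R
  proof (intro ballI impI)
    fix c c' assume c: "c \<in> C" "c' \<in> C" and "\<forall>q\<in>set qs. c \<bullet> q = c' \<bullet> q"
    then have "map (\<lambda>q. c \<bullet> q) qs = map (\<lambda>q. c' \<bullet> q) qs"
      by simp
    then show "argmin_set X c = argmin_set X c'"
      using Xhat[OF c(1)] Xhat[OF c(2)] by metis
  qed
next
  assume R: ?R
  \<comment> \<open>The union ranges over all costs in \<open>C\<close> consistent with
    \<open>ys\<close>. On attained data its members coincide; on other lists it is empty, hence
    still a subset of \<open>X\<close>.\<close>
  define Xhat where
    "Xhat ys = \<Union> (argmin_set X ` {c \<in> C. map (\<lambda>q. c \<bullet> q) qs = ys})" for ys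
  have "Xhat ys \<subseteq> X" for ys
    by (auto simp: Xhat_def argmin_set_iff)
  moreover have "Xhat (map (\<lambda>q. c \<bullet> q) qs) = argmin_set X c" if "c \<in> C" for c
  proof -
    have "argmin_set X c' = argmin_set X c"
      if "c' \<in> C" "map (\<lambda>q. c' \<bullet> q) qs = map (\<lambda>q. c \<bullet> q) qs" for c'
      by (rule R[rule_format, OF that(1) \<open>c \<in> C\<close>]) (use that(2) in simp)
    then show ?thesis
      unfolding Xhat_def using \<open>c \<in> C\<close> by blast
  qed
  ultimately show ?L
    unfolding sufficient_dataset_def by (intro exI[of _ Xhat] conjI allI impI ballI)
qed

section \<open>Extreme directions of a polytope\<close>

text \<open>The functional \<open>w\<close> reads off the scale of a vector of the cone. Dividing a
  decomposition of a point of the ray by its scale exhibits \<open>p\<close> as a convex combination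
  of points of \<open>B\<close>, where extremality applies.\<close>

lemma ray_face_of_conic_hull:
  fixes B :: "'a::euclidean_space set"
  assumes p: "p extreme_point_of B" and B: "\<And>x. x \<in> B \<Longrightarrow> w \<bullet> x = 1"
  shows "conic hull {p} face_of conic hull B"
proof -
  have pB: "p \<in> B"
    using p by (simp add: extreme_point_of_def)
  have ends: "a \<in> conic hull {p} \<and> b \<in> conic hull {p}"
    if ab: "a \<in> conic hull B" "b \<in> conic hull B"
      and z: "z \<in> conic hull {p}" "z \<in> open_segment a b" for a b z
  proof -
    obtain \<alpha> a' where a: "a = \<alpha> *\<^sub>R a'" "0 \<le> \<alpha>" "a' \<in> B"
      using ab(1) by (auto simp: conic_hull_explicit)
    obtain \<beta> b' where b: "b = \<beta> *\<^sub>R b'" "0 \<le> \<beta>" "b' \<in> B"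
      using ab(2) by (auto simp: conic_hull_explicit)
    obtain t where t: "z = t *\<^sub>R p" "0 \<le> t"
      using z(1) by (auto simp: conic_hull_explicit)
    obtain u where u: "z = (1 - u) *\<^sub>R a + u *\<^sub>R b" "0 < u" "u < 1"
      using z(2) by (auto simp: in_segment)
    have "w \<bullet> z = (1 - u) * \<alpha> + u * \<beta>"
      using u a b B by (simp add: inner_add_right)
    then have t_eq: "t = (1 - u) * \<alpha> + u * \<beta>"
      using t B[OF pB] by simp
    have ray: "s *\<^sub>R p \<in> conic hull {p}" if "0 \<le> s" for s
      using that by (auto simp: conic_hull_explicit)
    \<comment> \<open>If one endpoint is the apex \<open>0\<close>, then \<open>z\<close> is a
      positive multiple of the other one. Only two nonzero endpoints call for extremality of
      \<open>p\<close>.\<close>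
    consider "\<alpha> = 0" | "\<beta> = 0" | "0 < \<alpha>" "0 < \<beta>"
      using a(2) b(2) by linarith
    then show ?thesis
    proof cases
      case 1
      then have "u *\<^sub>R b = u *\<^sub>R (\<beta> *\<^sub>R p)"
        using u(1) t(1) t_eq a(1) by simp
      then have "b = \<beta> *\<^sub>R p"
        using u(2) unfolding scaleR_cancel_left by simp
      then show ?thesis
        using 1 a(1) b(2) ray[of 0] ray[of \<beta>] by simp
    next
      case 2
      then have "(1 - u) *\<^sub>R a = (1 - u) *\<^sub>R (\<alpha> *\<^sub>R p)"
        using u(1) t(1) t_eq b(1) by simp
      then have "a = \<alpha> *\<^sub>R p"
        using u(3) unfolding scaleR_cancel_left by simp
      then show ?thesis
        using 2 b(1) a(2) ray[of 0] ray[of \<alpha>] by simp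
    next
      case 3
      \<comment> \<open>Dividing by \<open>t\<close> turns the coefficients of \<open>a'\<close> and
        \<open>b'\<close> into \<open>1 - v\<close> and \<open>v\<close>; they sum to one by
        \<open>t_eq\<close>.\<close>
      define v where "v = u * \<beta> / t"
      have "0 < t"
        unfolding t_eq using 3 u by (intro add_pos_pos mult_pos_pos) auto
      have "0 < v"
        unfolding v_def using 3 u \<open>0 < t\<close> by simp
      have v1: "1 - v = (1 - u) * \<alpha> / t"
        unfolding v_def using \<open>0 < t\<close> t_eq by (simp add: field_simps)
      have "0 < (1 - u) * \<alpha> / t"
        using 3 u \<open>0 < t\<close> by simp
      then have "v < 1"
        using v1 by linarith
      have "t *\<^sub>R p = ((1 - u) * \<alpha>) *\<^sub>R a' + (u * \<beta>) *\<^sub>R b'"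
        using u(1) t(1) a(1) b(1) by simp
      then have "(1 / t) *\<^sub>R (t *\<^sub>R p) = (1 - v) *\<^sub>R a' + v *\<^sub>R b'"
        unfolding v1 by (simp add: v_def scaleR_right_distrib)
      then have p_eq: "p = (1 - v) *\<^sub>R a' + v *\<^sub>R b'"
        using \<open>0 < t\<close> by simp
      have "a' = b'"
      proof (rule ccontr)
        assume "a' \<noteq> b'"
        then have "p \<in> open_segment a' b'"
          unfolding in_segment(2) using p_eq \<open>0 < v\<close> \<open>v < 1\<close> by (intro conjI exI[of _ v])
        then show False
          using p a(3) b(3) by (simp add: extreme_point_of_def)
      qed
      then have "p = b'"
        using p_eq by (simp flip: scaleR_left_distrib)
      then have "a' = p" "b' = p"
        using \<open>a' = b'\<close> by simp_all
      then show ?thesis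
        using a b ray by simp
    qed
  qed
  have "conic hull {p} \<subseteq> conic hull B"
    using pB by (intro hull_mono) simp
  then show ?thesis
    unfolding face_of_def by (intro conjI ballI impI convex_conic_hull convex_singleton)
      (use ends in blast)+
qed

text \<open>The feasible cone has the base \<open>B\<close>, obtained by scaling the vectors from \<open>x\<close> to the other
  vertices into the hyperplane \<open>w \<bullet> y = 1\<close>, where \<open>w\<close> exposes \<open>x\<close>. The extreme points of \<open>B\<close> are the
  required directions.\<close>

lemma finite_extreme_directions_certify_optimality:
  fixes X :: "'a::euclidean_space set"
  assumes X: "polytope X" and x: "x extreme_point_of X"
  obtains E where "finite E" "E \<subseteq> extreme_directions X x"
    and "\<And>c. (\<And>\<delta>. \<delta> \<in> E \<Longrightarrow> 0 \<le> c \<bullet> \<delta>) \<Longrightarrow> x \<in> argmin_set X c"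
proof -
  have xX: "x \<in> X"
    using x by (simp add: extreme_point_of_def)
  obtain V where V: "finite V" "X = convex hull V"
    using X by (auto simp: polytope_def)
  have VX: "V \<subseteq> X"
    using V by (simp add: hull_subset)
  have "{x} exposed_face_of X"
    using x X by (simp add: exposed_face_of_polyhedron polytope_imp_polyhedron face_of_singleton)
  then obtain a r where a: "X \<subseteq> {y. a \<bullet> y \<le> r}" "{x} = X \<inter> {y. a \<bullet> y = r}"
    unfolding exposed_face_of_def by blast
  \<comment> \<open>Vertices of a polyhedron are exposed. After the sign change the functional has
    its strict minimum over \<open>X\<close> at \<open>x\<close>, so the scaling factors in
    \<open>P\<close> are positive.\<close>
  define w where "w = - a"
  have w: "0 < w \<bullet> (y - x)" if "y \<in> X" "y \<noteq> x" for y
  proof -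
    have "a \<bullet> x = r" "a \<bullet> y \<le> r" "a \<bullet> y \<noteq> r"
      using a that by blast+
    then show ?thesis
      by (simp add: w_def inner_diff_right)
  qed
  define P where "P = (\<lambda>v. (1 / (w \<bullet> (v - x))) *\<^sub>R (v - x)) ` (V - {x})"
  define B where "B = convex hull P"
  define E where "E = {p. p extreme_point_of B}"
  have "finite P"
    using V by (simp add: P_def)
  have "E \<subseteq> P"
    unfolding E_def B_def by (rule extreme_points_of_convex_hull)
  have "B = convex hull E"
    unfolding B_def E_def using \<open>finite P\<close> by (rule Krein_Milman_polytope)
  have wP: "w \<bullet> p = 1" if "p \<in> P" for p
  proof -
    obtain v where "v \<in> V" "v \<noteq> x" "p = (1 / (w \<bullet> (v - x))) *\<^sub>R (v - x)"
      using \<open>p \<in> P\<close> unfolding P_def by blast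
    then show ?thesis
      using w[of v] VX by auto
  qed
  have "B \<subseteq> {y. w \<bullet> y = 1}"
    unfolding B_def using wP by (intro hull_minimal) (auto intro: convex_hyperplane)
  then have wB: "w \<bullet> y = 1" if "y \<in> B" for y
    using that by blast
  have V_P: "\<exists>p\<in>P. \<exists>g\<ge>0. v - x = g *\<^sub>R p" if "v \<in> V" "v \<noteq> x" for v
  proof -
    have "0 < w \<bullet> (v - x)"
      using w that VX by blast
    then have "v - x = (w \<bullet> (v - x)) *\<^sub>R ((1 / (w \<bullet> (v - x))) *\<^sub>R (v - x))"
      by simp
    moreover have "(1 / (w \<bullet> (v - x))) *\<^sub>R (v - x) \<in> P"
      using that by (auto simp: P_def)
    ultimately show ?thesis
      using \<open>0 < w \<bullet> (v - x)\<close> by (meson less_imp_le)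
  qed
  have "E \<subseteq> extreme_directions X x"
  proof
    fix p assume "p \<in> E"
    then have "p \<in> P" and pB: "p extreme_point_of B"
      using \<open>E \<subseteq> P\<close> by (auto simp: E_def)
    then obtain v where v: "v \<in> V" "v \<noteq> x" "p = (1 / (w \<bullet> (v - x))) *\<^sub>R (v - x)"
      unfolding P_def by blast
    define g where "g = w \<bullet> (v - x)"
    have "0 < g"
      using w v VX by (auto simp: g_def)
    have gp: "g *\<^sub>R p = v - x"
      using v(3) \<open>0 < g\<close> by (simp add: g_def)
    have "p \<noteq> 0"
      using wP[OF \<open>p \<in> P\<close>] by auto
    have ray: "conic hull {p} \<subseteq> feasible_directions X x"
    proof
      fix y assume "y \<in> conic hull {p}"
      then obtain t where t: "y = t *\<^sub>R p" "0 \<le> t"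
        by (auto simp: conic_hull_explicit)
      have "\<exists>\<epsilon>>0. x + \<epsilon> *\<^sub>R y \<in> X"
      proof (cases "t = 0")
        case True
        then show ?thesis
          using t xX by (intro exI[of _ 1]) simp
      next
        case False
        then have "x + (g / t) *\<^sub>R y = v"
          using t gp by simp
        moreover have "v \<in> X" "0 < g / t"
          using v VX False t \<open>0 < g\<close> by auto
        ultimately show ?thesis
          by metis
      qed
      then show "y \<in> feasible_directions X x"
        by (simp add: feasible_directions_def)
    qed
    \<comment> \<open>This makes \<open>B\<close> nonempty, so that its conic hull contains
      \<open>0\<close>, which covers the vertex \<open>v = x\<close> below.\<close>
    have "p \<in> B"
      using pB by (simp add: extreme_point_of_def)
    have "V \<subseteq> (+) x ` (conic hull B)"
    proof
      fix v assume "v \<in> V"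
      have "v - x \<in> conic hull B"
      proof (cases "v = x")
        case True
        then show ?thesis
          using \<open>p \<in> B\<close> by (auto simp: conic_hull_contains_0)
      next
        case False
        moreover have "P \<subseteq> B"
          by (simp add: B_def hull_subset)
        ultimately show ?thesis
          using V_P[OF \<open>v \<in> V\<close>] by (auto simp: conic_hull_explicit)
      qed
      then show "v \<in> (+) x ` (conic hull B)"
        by (intro image_eqI[of _ _ "v - x"]) simp_all
    qed
    then have X_sub: "X \<subseteq> (+) x ` (conic hull B)"
      unfolding V by (intro hull_minimal convex_translation convex_conic_hull) (auto simp: B_def)
    have FD_sub: "feasible_directions X x \<subseteq> conic hull B"
    proof
      fix y assume "y \<in> feasible_directions X x"
      then obtain \<epsilon> where \<epsilon>: "0 < \<epsilon>" "x + \<epsilon> *\<^sub>R y \<in> X"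
        by (auto simp: feasible_directions_def)
      then have "\<epsilon> *\<^sub>R y \<in> conic hull B"
        using X_sub by auto
      then have "(1 / \<epsilon>) *\<^sub>R (\<epsilon> *\<^sub>R y) \<in> conic hull B"
        using \<epsilon>(1) by (simp only: conic_mul[OF conic_conic_hull] zero_le_divide_1_iff less_imp_le)
      moreover have "(1 / \<epsilon>) *\<^sub>R (\<epsilon> *\<^sub>R y) = y"
        using \<epsilon> by simp
      ultimately show "y \<in> conic hull B"
        by (simp only:)
    qed
    \<comment> \<open>A face of \<open>conic hull B\<close> is also a face of the set of feasible
      directions, which lies between the ray and that cone.\<close>
    have "conic hull {p} face_of conic hull B"
      using pB wB by (rule ray_face_of_conic_hull)
    then show "p \<in> extreme_directions X x"
      using face_of_subset ray FD_sub \<open>p \<noteq> 0\<close> by (auto simp: extreme_directions_def)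
  qed
  moreover have "x \<in> argmin_set X c" if c: "\<And>\<delta>. \<delta> \<in> E \<Longrightarrow> 0 \<le> c \<bullet> \<delta>" for c
  proof -
    \<comment> \<open>Nonnegativity of \<open>c\<close> spreads from \<open>E\<close> to its hull
      \<open>B\<close>, hence to \<open>P\<close> and to all \<open>v - x\<close>; so
      \<open>c\<close> is minimal at \<open>x\<close> on \<open>V\<close> and therefore on
      \<open>X\<close>.\<close>
    have "B \<subseteq> {y. c \<bullet> y \<ge> 0}"
      unfolding \<open>B = convex hull E\<close> using c
      by (intro hull_minimal) (auto intro: convex_halfspace_ge)
    then have P: "0 \<le> c \<bullet> p" if "p \<in> P" for p
      using that hull_subset[of P convex] by (auto simp: B_def)
    have "c \<bullet> x \<le> c \<bullet> v" if "v \<in> V" for v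
    proof (cases "v = x")
      case False
      then obtain p g where "p \<in> P" "0 \<le> g" "v - x = g *\<^sub>R p"
        using V_P[OF \<open>v \<in> V\<close>] by blast
      then have "0 \<le> c \<bullet> (v - x)"
        using P by simp
      then show ?thesis
        by (simp add: inner_diff_right)
    qed simp
    then have "X \<subseteq> {y. c \<bullet> y \<ge> c \<bullet> x}"
      unfolding V(2) by (intro hull_minimal) (auto intro: convex_halfspace_ge)
    then show ?thesis
      using xX by (auto simp: argmin_set_iff)
  qed
  ultimately show thesis
    using that \<open>finite P\<close> \<open>E \<subseteq> P\<close> finite_subset by blast
qed

section \<open>Costs with the same data\<close>

lemma inner_feasible_direction_nonneg:
  assumes "x \<in> argmin_set X c" "\<delta> \<in> feasible_directions X x"
  shows "0 \<le> c \<bullet> \<delta>"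
proof -
  obtain \<epsilon> where \<epsilon>: "0 < \<epsilon>" "x + \<epsilon> *\<^sub>R \<delta> \<in> X"
    using assms(2) by (auto simp: feasible_directions_def)
  then have "c \<bullet> x \<le> c \<bullet> (x + \<epsilon> *\<^sub>R \<delta>)"
    using assms(1) by (auto simp: argmin_set_iff)
  then show ?thesis
    using \<epsilon> by (simp add: inner_add_right zero_le_mult_iff)
qed

lemma extreme_directions_subset: "extreme_directions X x \<subseteq> feasible_directions X x"
proof
  fix \<delta> assume "\<delta> \<in> extreme_directions X x"
  then have "conic hull {\<delta>} \<subseteq> feasible_directions X x"
    by (auto simp: extreme_directions_def dest: face_of_imp_subset)
  then show "\<delta> \<in> feasible_directions X x"
    using hull_subset[of "{\<delta>}" conic] by blast
qed

text \<open>This is a ratio test along the segment from \<open>c\<close> to \<open>c'\<close>: the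
  first direction of \<open>E\<close> to become tight is relevant, yet \<open>c\<close> and
  \<open>c'\<close> differ on it.\<close>

lemma optimal_vertex_transfer:
  fixes X :: "'a::euclidean_space set"
  assumes X: "polytope X" and x: "x extreme_point_of X"
    and C: "convex C" "c \<in> C" "c' \<in> C"
    and rel: "\<And>\<delta>. \<delta> \<in> relevant_extreme_directions X C \<Longrightarrow> c \<bullet> \<delta> = c' \<bullet> \<delta>"
    and opt: "x \<in> argmin_set X c"
  shows "x \<in> argmin_set X c'"
proof (rule ccontr)
  assume nopt: "x \<notin> argmin_set X c'"
  obtain E where E: "finite E" "E \<subseteq> extreme_directions X x"
    and certify: "\<And>c. (\<And>\<delta>. \<delta> \<in> E \<Longrightarrow> 0 \<le> c \<bullet> \<delta>) \<Longrightarrow> x \<in> argmin_set X c"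
    using finite_extreme_directions_certify_optimality[OF X x] by metis
  have c_nonneg: "0 \<le> c \<bullet> \<delta>" if "\<delta> \<in> E" for \<delta>
    using inner_feasible_direction_nonneg[OF opt] extreme_directions_subset E that by blast
  define T where "T = {\<delta> \<in> E. c' \<bullet> \<delta> < 0}"
  \<comment> \<open>The parameter at which the cost of the direction, affine along the segment,
    vanishes. The denominator is positive on \<open>T\<close>.\<close>
  define \<tau> where "\<tau> \<delta> = c \<bullet> \<delta> / (c \<bullet> \<delta> - c' \<bullet> \<delta>)" for \<delta>
  have "finite T" "T \<noteq> {}"
    using E certify[of c'] nopt by (auto simp: T_def not_less)
  then obtain \<delta> where \<delta>: "\<delta> \<in> T" "\<And>\<eta>. \<eta> \<in> T \<Longrightarrow> \<tau> \<delta> \<le> \<tau> \<eta>"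
    using arg_min_if_finite(1) arg_min_least by metis
  define t where "t = \<tau> \<delta>"
  define d where "d = (1 - t) *\<^sub>R c + t *\<^sub>R c'"
  have \<delta>E: "\<delta> \<in> E" "c' \<bullet> \<delta> < 0" "0 \<le> c \<bullet> \<delta>"
    using \<delta> c_nonneg by (auto simp: T_def)
  have t: "0 \<le> t" "t \<le> 1"
    using \<delta>E by (auto simp: t_def \<tau>_def divide_simps)
  have d_inner: "d \<bullet> \<eta> = c \<bullet> \<eta> - t * (c \<bullet> \<eta> - c' \<bullet> \<eta>)" for \<eta>
    by (simp add: d_def inner_add_left algebra_simps)
  have "d \<in> C"
    unfolding d_def using C t by (simp add: convexD_alt)
  \<comment> \<open>On \<open>T\<close> this is minimality of \<open>t\<close>; outside
    \<open>T\<close> both ends of the segment are nonnegative.\<close>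
  have "0 \<le> d \<bullet> \<eta>" if "\<eta> \<in> E" for \<eta>
  proof (cases "\<eta> \<in> T")
    case True
    then have "0 < c \<bullet> \<eta> - c' \<bullet> \<eta>"
      using c_nonneg[OF that] by (simp add: T_def)
    moreover have "t \<le> c \<bullet> \<eta> / (c \<bullet> \<eta> - c' \<bullet> \<eta>)"
      using \<delta>(2)[OF True] by (simp add: t_def \<tau>_def)
    ultimately show ?thesis
      by (simp add: d_inner pos_le_divide_eq)
  next
    case False
    then have "0 \<le> c \<bullet> \<eta>" "0 \<le> c' \<bullet> \<eta>"
      using c_nonneg that by (auto simp: T_def)
    then show ?thesis
      using t by (simp add: d_def inner_add_left)
  qed
  then have "x \<in> argmin_set X d"
    by (rule certify)
  moreover have "d \<bullet> \<delta> = 0"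
    using \<delta>E by (simp add: d_inner t_def \<tau>_def)
  ultimately have "d \<in> optimality_face X x \<delta>"
    by (simp add: optimality_face_def optimality_cone_def orthogonal_comp_def orthogonal_def
        inner_commute)
  then have "\<delta> \<in> relevant_extreme_directions X C"
    using x \<delta>E E \<open>d \<in> C\<close> by (auto simp: relevant_extreme_directions_def)
  then show False
    using rel \<delta>E by fastforce
qed

section \<open>Directions of the uncertainty set and orthogonality\<close>

lemma diff_in_dir: "x \<in> S \<Longrightarrow> y \<in> S \<Longrightarrow> x - y \<in> dir S"
  unfolding dir_def by (blast intro: span_base)

text \<open>The affine hull of \<open>C\<close> is \<open>c\<close> plus the span of
  \<open>C\<close> translated by \<open>- c\<close>, and this span contains \<open>dir C\<close>. A
  short step along \<open>s\<close> thus stays in the hull and in a ball around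
  \<open>c\<close>.\<close>

lemma rel_open_shift_along_dir:
  fixes C :: "'a::euclidean_space set"
  assumes "rel_open C" "c \<in> C" "s \<in> dir C"
  obtains e where "0 < e" "c + e *\<^sub>R s \<in> C"
proof -
  have "c \<in> rel_interior C"
    using assms by (simp add: rel_open_def)
  then obtain r where r: "0 < r" "cball c r \<inter> affine hull C \<subseteq> C"
    by (auto simp: mem_rel_interior_cball)
  \<comment> \<open>Adding 1 keeps the denominator positive when \<open>s = 0\<close>.\<close>
  define e where "e = r / (norm s + 1)"
  have "0 < norm s + 1"
    by (simp add: add_nonneg_pos)
  have "0 < e"
    using r \<open>0 < norm s + 1\<close> by (simp add: e_def)
  have "dir C \<subseteq> span ((\<lambda>x. - c + x) ` C)"
    unfolding dir_def
  proof (intro span_minimal subspace_span subsetI, clarify)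
    fix x y assume "x \<in> C" "y \<in> C"
    then have "(- c + x) - (- c + y) \<in> span ((\<lambda>x. - c + x) ` C)"
      by (intro span_diff span_base imageI)
    then show "x - y \<in> span ((\<lambda>x. - c + x) ` C)"
      by simp
  qed
  then have "e *\<^sub>R s \<in> span ((\<lambda>x. - c + x) ` C)"
    using assms(3) by (blast intro: span_scale)
  then have "c + e *\<^sub>R s \<in> affine hull C"
    using affine_hull_span_gen[OF hull_inc[OF assms(2), of affine]] by blast
  moreover have "norm (e *\<^sub>R s) \<le> r"
    using r \<open>0 < norm s + 1\<close> by (simp add: e_def divide_simps)
  then have "c + e *\<^sub>R s \<in> cball c r"
    by (simp add: dist_norm)
  ultimately show thesis
    using that \<open>0 < e\<close> r by blast
qed

lemma relevant_direction_orthogonal_if_sufficient: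
  fixes X :: "'a::euclidean_space set"
  assumes C: "rel_open C" and suff: "sufficient_dataset qs C X"
    and \<delta>: "\<delta> \<in> relevant_extreme_directions X C"
    and s: "s \<in> dir C" "\<And>q. q \<in> set qs \<Longrightarrow> s \<bullet> q = 0"
  shows "s \<bullet> \<delta> = 0"
proof -
  obtain x c where ext: "\<delta> \<in> extreme_directions X x" and "c \<in> C"
    and opt: "x \<in> argmin_set X c" and tight: "c \<bullet> \<delta> = 0"
    using \<delta> by (auto simp: relevant_extreme_directions_def optimality_face_def optimality_cone_def
        orthogonal_comp_def orthogonal_def inner_commute)
  obtain \<epsilon> where \<epsilon>: "0 < \<epsilon>" "x + \<epsilon> *\<^sub>R \<delta> \<in> X"
    using ext extreme_directions_subset[of X x] by (auto simp: feasible_directions_def)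
  obtain e where e: "0 < e" "c + e *\<^sub>R s \<in> C"
    using rel_open_shift_along_dir[OF C \<open>c \<in> C\<close> s(1)] by blast
  have "argmin_set X (c + e *\<^sub>R s) = argmin_set X c"
    by (rule suff[unfolded sufficient_dataset_iff, rule_format, OF e(2) \<open>c \<in> C\<close>])
      (simp add: inner_add_left s(2))
  \<comment> \<open>Tightness \<open>c \<bullet> \<delta> = 0\<close> makes this neighbour of
    \<open>x\<close> optimal too. Both points then stay optimal for the shifted cost, and comparing
    their values isolates \<open>s \<bullet> \<delta>\<close>.\<close>
  moreover have "x + \<epsilon> *\<^sub>R \<delta> \<in> argmin_set X c"
    using opt \<epsilon>(2) tight by (simp add: argmin_set_iff inner_add_right)
  ultimately have "x + \<epsilon> *\<^sub>R \<delta> \<in> argmin_set X (c + e *\<^sub>R s)" "x \<in> argmin_set X (c + e *\<^sub>R s)"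
    using opt by simp_all
  then have "(c + e *\<^sub>R s) \<bullet> (x + \<epsilon> *\<^sub>R \<delta>) = (c + e *\<^sub>R s) \<bullet> x"
    unfolding argmin_set_iff by (meson order_antisym)
  then have "e * (\<epsilon> * (s \<bullet> \<delta>)) = 0"
    using tight by (simp add: inner_add_left inner_add_right algebra_simps)
  then show ?thesis
    using e \<epsilon> by simp
qed

text \<open>A subspace of a Euclidean space is its own double complement, and the complement of the
  sum consists of the vectors of \<open>L\<close> orthogonal to \<open>Q\<close>.\<close>

lemma in_orthogonal_comp_plus_span_iff:
  fixes L Q :: "'a::euclidean_space set"
  assumes L: "subspace L"
  shows "\<delta> \<in> orthogonal_comp L + span Q \<longleftrightarrow>
    (\<forall>s\<in>L. (\<forall>q\<in>Q. s \<bullet> q = 0) \<longrightarrow> s \<bullet> \<delta> = 0)"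
proof
  assume "\<delta> \<in> orthogonal_comp L + span Q"
  then obtain y z where yz: "\<delta> = y + z" "y \<in> orthogonal_comp L" "z \<in> span Q"
    by (auto elim: set_plus_elim)
  have "s \<bullet> \<delta> = 0" if "s \<in> L" "\<forall>q\<in>Q. s \<bullet> q = 0" for s
  proof -
    have "s \<bullet> y = 0"
      using yz(2) that(1) by (simp add: orthogonal_comp_def orthogonal_def)
    moreover have "orthogonal s z"
      using that(2) by (intro orthogonal_to_span[OF yz(3)]) (simp add: orthogonal_def)
    ultimately show ?thesis
      using yz(1) by (simp add: inner_add_right orthogonal_def)
  qed
  then show "\<forall>s\<in>L. (\<forall>q\<in>Q. s \<bullet> q = 0) \<longrightarrow> s \<bullet> \<delta> = 0"
    by blast
next
  assume *: "\<forall>s\<in>L. (\<forall>q\<in>Q. s \<bullet> q = 0) \<longrightarrow> s \<bullet> \<delta> = 0"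
  let ?M = "orthogonal_comp L + span Q"
  have "?M = {x + y |x y. x \<in> orthogonal_comp L \<and> y \<in> span Q}"
    by (auto simp: set_plus_def)
  then have M: "subspace ?M"
    using subspace_sums[OF subspace_orthogonal_comp subspace_span] by simp
  have "orthogonal_comp L \<subseteq> ?M"
    using set_plus_intro[of _ "orthogonal_comp L" 0 "span Q"] span_zero by force
  then have "orthogonal_comp ?M \<subseteq> L"
    using orthogonal_comp_anti_mono orthogonal_comp_self[OF L] by blast
  moreover have "Q \<subseteq> ?M"
    using set_plus_intro[of 0 "orthogonal_comp L" _ "span Q"] span_base
      subspace_0[OF subspace_orthogonal_comp] by force
  then have "s \<bullet> q = 0" if "s \<in> orthogonal_comp ?M" "q \<in> Q" for s q
    using that by (auto simp: orthogonal_comp_def orthogonal_def inner_commute)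
  ultimately have "\<delta> \<in> orthogonal_comp (orthogonal_comp ?M)"
    using * by (auto simp: orthogonal_comp_def[of "orthogonal_comp ?M"] orthogonal_def)
  then show "\<delta> \<in> ?M"
    by (simp only: orthogonal_comp_self[OF M])
qed

section \<open>The decision set and the equivalence\<close>

lemma polyhedron_decision_set: "polyhedron (decision_set A b)"
proof -
  have "decision_set A b =
      (\<Inter>i. {x. row i A \<bullet> x = b $ i}) \<inter> (\<Inter>i. {x. axis i 1 \<bullet> x \<ge> 0})"
    by (auto simp: decision_set_def vec_eq_iff matrix_vector_mul_component row_def inner_axis'
        vec_lambda_eta)
  also have "polyhedron \<dots>"
    by (intro polyhedron_Int polyhedron_Inter)
      (auto simp: polyhedron_hyperplane polyhedron_halfspace_ge)
  finally show ?thesis .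
qed

theorem theorem1:
  fixes A :: "real ^ 'd ^ 'm" and b :: "real ^ 'm"
    and C :: "(real ^ 'd) set" and qs :: "(real ^ 'd) list"
  assumes "bounded (decision_set A b)"
    and "convex C" and "rel_open C"
  shows "sufficient_dataset qs C (decision_set A b) \<longleftrightarrow>
         relevant_extreme_directions (decision_set A b) C
           \<subseteq> orthogonal_comp (dir C) + span (set qs)"
proof -
  let ?X = "decision_set A b"
  have X: "polytope ?X"
    using assms(1) polyhedron_decision_set by (simp add: polytope_eq_bounded_polyhedron)
  have dir: "subspace (dir C)"
    by (simp add: dir_def)
  note in_sum_iff = in_orthogonal_comp_plus_span_iff[OF dir]
  show ?thesis
  proof
    assume "sufficient_dataset qs C ?X"
    then show "relevant_extreme_directions ?X C \<subseteq> orthogonal_comp (dir C) + span (set qs)"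
      using relevant_direction_orthogonal_if_sufficient[OF assms(3)]
      by (auto simp: in_sum_iff)
  next
    assume sub: "relevant_extreme_directions ?X C \<subseteq> orthogonal_comp (dir C) + span (set qs)"
    \<comment> \<open>The difference \<open>c - c'\<close> lies in \<open>dir C\<close> and is
      orthogonal to the data, hence to every relevant direction. Exchanging \<open>c\<close> and
      \<open>c'\<close> gives the reverse inclusion.\<close>
    have "argmin_set ?X c \<subseteq> argmin_set ?X c'"
      if c: "c \<in> C" "c' \<in> C" and data: "\<forall>q\<in>set qs. c \<bullet> q = c' \<bullet> q" for c c'
    proof -
      have "c \<bullet> \<delta> = c' \<bullet> \<delta>" if "\<delta> \<in> relevant_extreme_directions ?X C" for \<delta>
      proof -
        have "\<delta> \<in> orthogonal_comp (dir C) + span (set qs)"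
          using sub that by blast
        moreover have "\<forall>q\<in>set qs. (c - c') \<bullet> q = 0"
          using data by (simp add: inner_diff_left)
        ultimately have "(c - c') \<bullet> \<delta> = 0"
          using diff_in_dir[OF c] unfolding in_sum_iff by blast
        then show ?thesis
          by (simp add: inner_diff_left)
      qed
      then show ?thesis
        using argmin_set_subset_if_extreme_points optimal_vertex_transfer[OF X _ assms(2) c] X
        by (metis polytope_imp_compact polytope_imp_convex)
    qed
    then show "sufficient_dataset qs C ?X"
      unfolding sufficient_dataset_iff by (metis subset_antisym)
  qed
qed

end
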